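(* Let $K\ge 2$ be an integer and let $(h_n)_{n\in\mathbb Z}$ be a sequence of monic palindromic polynomials in $\mathbb Q[x]$ with $h_n=h_{n-K}$ for all $n\in\mathbb Z$. Let $\mathcal F_K(Y_1,\dots,Y_K)$, its elements $a_n,b_n,Y_n$ ($n\in\mathbb Z$) and the subalgebra $\mathcal F_K$ be as defined in the context. For $n\in\mathbb Z$ let $\mathcal A_n$ be the $\mathbb Q$-subalgebra of $\mathcal F_K(Y_1,\dots,Y_K)$ generated by $\mathcal F_K$ and $Y_n,Y_{n+1},\dots,Y_{n+2K-1}$. Then $\mathcal A_n=\mathcal A_0$ for all $n\in\mathbb Z$.
   Context: A polynomial $h(x)=\sum_{i=0}^{d}P_i x^i\in\mathbb Q[x]$ of degree $d\ge 0$ is monic palindromic if $P_d=1$ and $P_i=P_{d-i}$ for all $0\le i\le d$ (so $P_0=P_d=1$). All algebras are associative and unital, not necessarily commutative. Fix $K\ge2$ and monic palindromic $h_n\in\mathbb Q[x]$ ($n\in\mathbb Z$) with $h_n=h_{n-K}$. $\mathcal F_K(Y_1,\dots,Y_K)$ is the $\mathbb Q$-algebra generated by invertible elements $a_1,\dots,a_K,b_1,\dots,b_K$ and invertible elements $Y_n$ ($n\in\mathbb Z$), subject only to the relation $$Y_1a_1Y_2a_2\cdots Y_Ka_K=b_KY_Kb_{K-1}Y_{K-1}\cdots b_1Y_1$$ and the recursion $$Y_{n+K}Y_n=h_n\left(a_nY_{n+1}a_{n+1}Y_{n+2}\cdots Y_{n+K-1}a_{n+K-1}\right)\qquad(n\in\mathbb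 Z),$$ where $a_n,b_n$ for all $n\in\mathbb Z$ are defined from $a_1,\dots,a_K,b_1,\dots,b_K$ by $a_{n+K}=b_n^{-1}$ and $b_{n+K}=a_n^{-1}$. Thus $Y_1,\dots,Y_K$ are the initial variables, and the recursion determines every other $Y_n$ from them. $\mathcal F_K$ is the $\mathbb Q$-subalgebra generated by $a_1^{\pm1},\dots,a_K^{\pm1},b_1^{\pm1},\dots,b_K^{\pm1}$. *)

theory Defs
  imports
    "HOL-Algebra.QuotRing"
    "HOL-Algebra.Generated_Rings"
    "HOL-Computational_Algebra.Polynomial"
    "HOL-Library.Poly_Mapping"
begin

text \<open>Free monoids, written additively because the convolution product of \<^typ>\<open>'a \<Rightarrow>\<^sub>0 'b\<close>
  expects a \<^class>\<open>monoid_add\<close> on the exponents (commutativity is not required).\<close>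

datatype 'x fmon = FMon (fmon_list: "'x list")

instantiation fmon :: (type) monoid_add
begin

definition zero_fmon :: "'a fmon" where
  "0 = FMon []"

definition plus_fmon :: "'a fmon \<Rightarrow> 'a fmon \<Rightarrow> 'a fmon" where
  "v + w = FMon (fmon_list v @ fmon_list w)"

instance
  by standard (simp_all add: zero_fmon_def plus_fmon_def)

end

text \<open>Noncommutative polynomials over the rationals.\<close>

type_synonym 'x ncpoly = "'x fmon \<Rightarrow>\<^sub>0 rat"

definition nc_const :: "rat \<Rightarrow> 'x ncpoly" where
  "nc_const c = Poly_Mapping.single 0 c"

definition nc_var :: "'x \<Rightarrow> 'x ncpoly" where
  "nc_var x = Poly_Mapping.single (FMon [x]) 1"

definition nc_eval :: "rat poly \<Rightarrow> 'x ncpoly \<Rightarrow> 'x ncpoly" where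
  "nc_eval p x = (\<Sum>i\<le>degree p. nc_const (coeff p i) * x ^ i)"

definition free_algebra :: "'x set \<Rightarrow> 'x ncpoly ring" where
  "free_algebra X =
    \<lparr> carrier = {p. \<forall>w\<in>Poly_Mapping.keys p. set (fmon_list w) \<subseteq> X},
      monoid.mult = (*), one = 1, zero = 0, add = (+) \<rparr>"

text \<open>The unital algebra with generators \<open>X\<close> and relations \<open>r = 0\<close> for \<open>r \<in> S\<close>, and the class
  of a noncommutative polynomial in it. \<^const>\<open>genideal\<close> is the two-sided ideal generated by a set.\<close>

definition presented_algebra :: "'x set \<Rightarrow> 'x ncpoly set \<Rightarrow> 'x ncpoly set ring" where
  "presented_algebra X S = free_algebra X Quot (Idl\<^bsub>free_algebra X\<^esub> S)"

definition pclass :: "'x set \<Rightarrow> 'x ncpoly set \<Rightarrow> 'x ncpoly \<Rightarrow> 'x ncpoly set" where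
  "pclass X S p = (Idl\<^bsub>free_algebra X\<^esub> S) +>\<^bsub>free_algebra X\<^esub> p"

text \<open>The unital subalgebra generated by a set \<open>G\<close> is the subring generated by \<open>G\<close> and the scalars.
  (The library's \<open>subalgebra\<close> is a linear subspace, not closed under multiplication.)\<close>

definition gen_subalgebra ::
    "'x set \<Rightarrow> 'x ncpoly set \<Rightarrow> 'x ncpoly set set \<Rightarrow> 'x ncpoly set set" where
  "gen_subalgebra X S G =
    generate_ring (presented_algebra X S) (range (\<lambda>c. pclass X S (nc_const c)) \<union> G)"

definition monic_palindromic :: "rat poly \<Rightarrow> bool" where
  "monic_palindromic p \<longleftrightarrow>
    lead_coeff p = 1 \<and> (\<forall>i\<le>degree p. coeff p i = coeff p (degree p - i))"

text \<open>Generators, and the letters consisting of generators and their formal inverses.\<close>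

datatype gen = GA int | GB int | GY int

datatype letter = Pos gen | Inv gen

fun linv :: "letter \<Rightarrow> letter" where
  "linv (Pos g) = Inv g"
| "linv (Inv g) = Pos g"

definition gens :: "int \<Rightarrow> gen set" where
  "gens K = GA ` {1..K} \<union> GB ` {1..K} \<union> range GY"

definition letters :: "int \<Rightarrow> letter set" where
  "letters K = Pos ` gens K \<union> Inv ` gens K"

text \<open>The letters for all \<open>a\<^sub>n\<close> and \<open>b\<^sub>n\<close>: write \<open>n = i + q K\<close> with \<open>1 \<le> i \<le> K\<close>; the rules
  \<open>a\<^sub>n\<^sub>+\<^sub>K = b\<^sub>n\<inverse>\<close> and \<open>b\<^sub>n\<^sub>+\<^sub>K = a\<^sub>n\<inverse>\<close> make both families \<open>2K\<close>-periodic, so only the parity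
  of \<open>q\<close> matters.\<close>

definition a_letter :: "int \<Rightarrow> int \<Rightarrow> letter" where
  "a_letter K n = (let i = (n - 1) mod K + 1; q = (n - 1) div K
    in if even q then Pos (GA i) else Inv (GB i))"

definition b_letter :: "int \<Rightarrow> int \<Rightarrow> letter" where
  "b_letter K n = (let i = (n - 1) mod K + 1; q = (n - 1) div K
    in if even q then Pos (GB i) else Inv (GA i))"

lemma ab_letter_initial:
  assumes "i \<in> {1..K}"
  shows "a_letter K i = Pos (GA i)" "b_letter K i = Pos (GB i)"
  using assms by (auto simp: a_letter_def b_letter_def div_pos_pos_trivial mod_pos_pos_trivial)

lemma ab_letter_shift:
  assumes "K > 0"
  shows "a_letter K (n + K) = linv (b_letter K n)" "b_letter K (n + K) = linv (a_letter K n)"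
proof -
  have eq: "n + K - 1 = (n - 1) + K" by simp
  have d: "(n + K - 1) div K = (n - 1) div K + 1"
    using assms unfolding eq by (subst div_add_self2) auto
  have m: "(n + K - 1) mod K = (n - 1) mod K"
    unfolding eq by simp
  show "a_letter K (n + K) = linv (b_letter K n)" "b_letter K (n + K) = linv (a_letter K n)"
    by (simp_all add: a_letter_def b_letter_def Let_def d m)
qed

definition var_a :: "int \<Rightarrow> int \<Rightarrow> letter ncpoly" where
  "var_a K n = nc_var (a_letter K n)"

definition var_b :: "int \<Rightarrow> int \<Rightarrow> letter ncpoly" where
  "var_b K n = nc_var (b_letter K n)"

definition var_Y :: "int \<Rightarrow> letter ncpoly" where
  "var_Y n = nc_var (Pos (GY n))"

definition relators :: "int \<Rightarrow> (int \<Rightarrow> rat poly) \<Rightarrow> letter ncpoly set" where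
  "relators K h =
     {nc_var l * nc_var (linv l) - 1 | l. l \<in> letters K}
   \<union> {prod_list (map (\<lambda>i. var_Y i * var_a K i) [1..K])
       - prod_list (map (\<lambda>i. var_b K i * var_Y i) (rev [1..K]))}
   \<union> {var_Y (n + K) * var_Y n
       - nc_eval (h n) (var_a K n * prod_list (map (\<lambda>i. var_Y i * var_a K i) [n+1..n+K-1]))
      | n. True}"

text \<open>The algebra \<open>\<F>\<^sub>K(Y\<^sub>1,\<dots>,Y\<^sub>K)\<close>, its elements \<open>a\<^sub>n\<close>, \<open>b\<^sub>n\<close>, \<open>Y\<^sub>n\<close>, and its subalgebras \<open>\<F>\<^sub>K\<close> and
  \<open>\<A>\<^sub>n\<close>.\<close>

definition FKY :: "int \<Rightarrow> (int \<Rightarrow> rat poly) \<Rightarrow> letter ncpoly set ring" where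
  "FKY K h = presented_algebra (letters K) (relators K h)"

definition cls :: "int \<Rightarrow> (int \<Rightarrow> rat poly) \<Rightarrow> letter ncpoly \<Rightarrow> letter ncpoly set" where
  "cls K h = pclass (letters K) (relators K h)"

definition elt_a :: "int \<Rightarrow> (int \<Rightarrow> rat poly) \<Rightarrow> int \<Rightarrow> letter ncpoly set" where
  "elt_a K h n = cls K h (var_a K n)"

definition elt_b :: "int \<Rightarrow> (int \<Rightarrow> rat poly) \<Rightarrow> int \<Rightarrow> letter ncpoly set" where
  "elt_b K h n = cls K h (var_b K n)"

definition elt_Y :: "int \<Rightarrow> (int \<Rightarrow> rat poly) \<Rightarrow> int \<Rightarrow> letter ncpoly set" where
  "elt_Y K h n = cls K h (var_Y n)"

definition FK :: "int \<Rightarrow> (int \<Rightarrow> rat poly) \<Rightarrow> letter ncpoly set set" where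
  "FK K h = gen_subalgebra (letters K) (relators K h)
     (\<Union>i\<in>{1..K}. {elt_a K h i, inv\<^bsub>FKY K h\<^esub> (elt_a K h i),
                   elt_b K h i, inv\<^bsub>FKY K h\<^esub> (elt_b K h i)})"

definition alg_A :: "int \<Rightarrow> (int \<Rightarrow> rat poly) \<Rightarrow> int \<Rightarrow> letter ncpoly set set" where
  "alg_A K h n = gen_subalgebra (letters K) (relators K h)
     (FK K h \<union> elt_Y K h ` {n..n+2*K-1})"


text \<open>The constructions above are rings, and the defining relations hold.\<close>

lemma fmon_list_plus [simp]: "fmon_list (v + w) = fmon_list v @ fmon_list w"
  by (simp add: plus_fmon_def)

lemma fmon_list_zero [simp]: "fmon_list 0 = []"
  by (simp add: zero_fmon_def)

lemma free_algebra_simps [simp]: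
  "monoid.mult (free_algebra X) = (*)" "one (free_algebra X) = 1"
  "zero (free_algebra X) = 0" "add (free_algebra X) = (+)"
  by (simp_all add: free_algebra_def)

lemma carrier_free_algebra:
  "p \<in> carrier (free_algebra X) \<longleftrightarrow> (\<forall>w\<in>Poly_Mapping.keys p. set (fmon_list w) \<subseteq> X)"
  by (simp add: free_algebra_def)

lemma free_algebra_closed:
  shows free_algebra_0: "0 \<in> carrier (free_algebra X)"
    and free_algebra_1: "1 \<in> carrier (free_algebra X)"
    and free_algebra_const: "nc_const c \<in> carrier (free_algebra X)"
    and free_algebra_var: "x \<in> X \<Longrightarrow> nc_var x \<in> carrier (free_algebra X)"
    and free_algebra_uminus: "p \<in> carrier (free_algebra X) \<Longrightarrow> - p \<in> carrier (free_algebra X)"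
    and free_algebra_add: "p \<in> carrier (free_algebra X) \<Longrightarrow> q \<in> carrier (free_algebra X)
      \<Longrightarrow> p + q \<in> carrier (free_algebra X)"
    and free_algebra_mult: "p \<in> carrier (free_algebra X) \<Longrightarrow> q \<in> carrier (free_algebra X)
      \<Longrightarrow> p * q \<in> carrier (free_algebra X)"
proof -
  show "0 \<in> carrier (free_algebra X)" "1 \<in> carrier (free_algebra X)"
    by (auto simp: carrier_free_algebra)
  show "nc_const c \<in> carrier (free_algebra X)"
    by (auto simp: carrier_free_algebra nc_const_def split: if_splits)
  show "x \<in> X \<Longrightarrow> nc_var x \<in> carrier (free_algebra X)"
    by (auto simp: carrier_free_algebra nc_var_def)
  show "p \<in> carrier (free_algebra X) \<Longrightarrow> - p \<in> carrier (free_algebra X)"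
    by (auto simp: carrier_free_algebra)
  show "p \<in> carrier (free_algebra X) \<Longrightarrow> q \<in> carrier (free_algebra X)
      \<Longrightarrow> p + q \<in> carrier (free_algebra X)"
    unfolding carrier_free_algebra using keys_add[of p q] by blast
  show "p * q \<in> carrier (free_algebra X)"
    if "p \<in> carrier (free_algebra X)" "q \<in> carrier (free_algebra X)"
    unfolding carrier_free_algebra
  proof
    fix w assume "w \<in> Poly_Mapping.keys (p * q)"
    then obtain u v where "w = u + v" "u \<in> Poly_Mapping.keys p" "v \<in> Poly_Mapping.keys q"
      using keys_mult[of p q] by auto
    then show "set (fmon_list w) \<subseteq> X"
      using that by (simp add: carrier_free_algebra)
  qed
qed

lemma free_algebra_diff:
  "p \<in> carrier (free_algebra X) \<Longrightarrow> q \<in> carrier (free_algebra X)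
    \<Longrightarrow> p - q \<in> carrier (free_algebra X)"
  using free_algebra_add[of p X "- q"] free_algebra_uminus[of q X] by simp

lemma free_algebra_power:
  "p \<in> carrier (free_algebra X) \<Longrightarrow> p ^ k \<in> carrier (free_algebra X)"
  by (induction k) (auto intro: free_algebra_1 free_algebra_mult)

lemma free_algebra_prod_list:
  "(\<And>p. p \<in> set ps \<Longrightarrow> p \<in> carrier (free_algebra X)) \<Longrightarrow> prod_list ps \<in> carrier (free_algebra X)"
  by (induction ps) (auto intro: free_algebra_1 free_algebra_mult)

lemma free_algebra_sum:
  "(\<And>i. i \<in> I \<Longrightarrow> f i \<in> carrier (free_algebra X)) \<Longrightarrow> sum f I \<in> carrier (free_algebra X)"
  by (induction I rule: infinite_finite_induct) (auto intro: free_algebra_0 free_algebra_add)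

lemma free_algebra_eval:
  "p \<in> carrier (free_algebra X) \<Longrightarrow> nc_eval f p \<in> carrier (free_algebra X)"
  unfolding nc_eval_def
  by (intro free_algebra_sum free_algebra_mult free_algebra_const free_algebra_power)

lemma ring_free_algebra: "ring (free_algebra X)"
proof (rule ringI)
  show "abelian_group (free_algebra X)"
  proof (rule abelian_groupI)
    show "\<exists>y\<in>carrier (free_algebra X). y \<oplus>\<^bsub>free_algebra X\<^esub> x = \<zero>\<^bsub>free_algebra X\<^esub>"
      if "x \<in> carrier (free_algebra X)" for x
      using free_algebra_uminus[OF that] by (intro bexI[of _ "- x"]) auto
  qed (auto simp: algebra_simps intro: free_algebra_0 free_algebra_add)
  show "monoid (free_algebra X)"
    by (rule monoidI) (auto simp: algebra_simps intro: free_algebra_1 free_algebra_mult)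
qed (auto simp: algebra_simps)

lemma linv_letters: "l \<in> letters K \<Longrightarrow> linv l \<in> letters K"
  by (auto simp: letters_def)

lemma letters_ab:
  assumes "K > 0"
  shows "a_letter K n \<in> letters K" "b_letter K n \<in> letters K"
proof -
  have "(n - 1) mod K + 1 \<in> {1..K}"
    using pos_mod_bound[OF assms, of "n - 1"] pos_mod_sign[OF assms, of "n - 1"]
    unfolding atLeastAtMost_iff by linarith
  then show "a_letter K n \<in> letters K" "b_letter K n \<in> letters K"
    by (auto simp: a_letter_def b_letter_def letters_def gens_def Let_def)
qed

lemma var_closed:
  assumes "K > 0"
  shows "var_a K n \<in> carrier (free_algebra (letters K))"
    and "var_b K n \<in> carrier (free_algebra (letters K))"
    and "var_Y n \<in> carrier (free_algebra (letters K))"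
  using letters_ab[OF assms, of n]
  by (auto simp: var_a_def var_b_def var_Y_def letters_def gens_def intro!: free_algebra_var)

lemma relators_closed:
  assumes "K > 0"
  shows "relators K h \<subseteq> carrier (free_algebra (letters K))"
proof -
  have 1: "nc_var l * nc_var (linv l) - 1 \<in> carrier (free_algebra (letters K))"
    if "l \<in> letters K" for l
    using that linv_letters[OF that]
    by (intro free_algebra_diff free_algebra_mult free_algebra_1 free_algebra_var)
  have 2: "prod_list (map (\<lambda>i. var_Y i * var_a K i) is) \<in> carrier (free_algebra (letters K))"
    "prod_list (map (\<lambda>i. var_b K i * var_Y i) is) \<in> carrier (free_algebra (letters K))" for "is"
    using var_closed[OF assms] by (auto intro!: free_algebra_prod_list free_algebra_mult)
  show ?thesis
    unfolding relators_def
    using 1 2 var_closed[OF assms]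
    by (auto intro!: free_algebra_diff free_algebra_mult free_algebra_eval
        free_algebra_var free_algebra_1 linv_letters)
qed

lemma ideal_relators:
  assumes "K > 0"
  shows "ideal (Idl\<^bsub>free_algebra (letters K)\<^esub> (relators K h)) (free_algebra (letters K))"
  by (rule ring.genideal_ideal[OF ring_free_algebra relators_closed[OF assms]])

lemma ring_FKY:
  assumes "K > 0"
  shows "ring (FKY K h)"
  unfolding FKY_def presented_algebra_def
  by (rule ideal.quotient_is_ring[OF ideal_relators[OF assms]])

lemma cls_hom:
  assumes "K > 0"
  shows "cls K h \<in> ring_hom (free_algebra (letters K)) (FKY K h)"
  using ideal.rcos_ring_hom[OF ideal_relators[OF assms]]
  by (simp add: cls_def[abs_def] pclass_def[abs_def] FKY_def presented_algebra_def)

lemma cls_eqI: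
  assumes "K > 0" "p \<in> carrier (free_algebra (letters K))"
    "q \<in> carrier (free_algebra (letters K))" "p - q \<in> relators K h"
  shows "cls K h p = cls K h q"
proof -
  interpret R: ring "free_algebra (letters K)" by (rule ring_free_algebra)
  interpret I: ideal "Idl\<^bsub>free_algebra (letters K)\<^esub> (relators K h)" "free_algebra (letters K)"
    by (rule ideal_relators[OF assms(1)])
  have "p - q \<in> Idl\<^bsub>free_algebra (letters K)\<^esub> (relators K h)"
    using R.genideal_self[OF relators_closed[OF assms(1)]] assms(4) by blast
  then have "p \<in> Idl\<^bsub>free_algebra (letters K)\<^esub> (relators K h) +>\<^bsub>free_algebra (letters K)\<^esub> q"
    by (force simp: a_r_coset_def r_coset_def)
  then show ?thesis
    unfolding cls_def pclass_def
    using R.a_repr_independence[OF _ assms(3) I.a_subgroup] by simp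
qed

lemma FKY_inverse:
  assumes "K > 0" "l \<in> letters K"
  shows "cls K h (nc_var l) \<otimes>\<^bsub>FKY K h\<^esub> cls K h (nc_var (linv l)) = \<one>\<^bsub>FKY K h\<^esub>"
proof -
  have c: "nc_var l \<in> carrier (free_algebra (letters K))"
    "nc_var (linv l) \<in> carrier (free_algebra (letters K))"
    using assms(2) linv_letters[OF assms(2)] by (auto intro: free_algebra_var)
  have "cls K h (nc_var l * nc_var (linv l)) = cls K h 1"
    by (rule cls_eqI[OF assms(1) free_algebra_mult[OF c] free_algebra_1])
       (use assms(2) in \<open>auto simp: relators_def\<close>)
  then show ?thesis
    using ring_hom_mult[OF cls_hom[OF assms(1)] c] ring_hom_one[OF cls_hom[OF assms(1)]]
    by simp
qed

lemma FKY_quasi_commutation: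
  assumes "K > 0"
  shows "cls K h (prod_list (map (\<lambda>i. var_Y i * var_a K i) [1..K])) =
    cls K h (prod_list (map (\<lambda>i. var_b K i * var_Y i) (rev [1..K])))"
  by (rule cls_eqI[OF assms])
     (use var_closed[OF assms] in \<open>auto simp: relators_def
        intro!: free_algebra_mult free_algebra_prod_list\<close>)

lemma FKY_recursion:
  assumes "K > 0"
  shows "elt_Y K h (n + K) \<otimes>\<^bsub>FKY K h\<^esub> elt_Y K h n =
    cls K h (nc_eval (h n)
      (var_a K n * prod_list (map (\<lambda>i. var_Y i * var_a K i) [n+1..n+K-1])))"
proof -
  note v = var_closed[OF assms]
  have "cls K h (var_Y (n + K) * var_Y n) = cls K h (nc_eval (h n)
      (var_a K n * prod_list (map (\<lambda>i. var_Y i * var_a K i) [n+1..n+K-1])))"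
    by (rule cls_eqI[OF assms])
       (use v in \<open>auto simp: relators_def
          intro!: free_algebra_eval free_algebra_mult free_algebra_prod_list\<close>)
  then show ?thesis
    using ring_hom_mult[OF cls_hom[OF assms], of "var_Y (n + K)" "var_Y n"] v
    by (simp add: elt_Y_def)
qed

end

theory Submission
  imports Defs
begin

text \<open>Write \<open>X\<^sub>n\<close> and \<open>Z\<^sub>n\<close> for the arguments of \<open>h\<^sub>n\<close> in \<open>Y\<^sub>n\<^sub>+\<^sub>K Y\<^sub>n = h\<^sub>n(X\<^sub>n)\<close> and
  \<open>Y\<^sub>n Y\<^sub>n\<^sub>+\<^sub>K = h\<^sub>n(Z\<^sub>n)\<close>, and put \<open>y = Y\<^sub>n\<^sub>+\<^sub>K\<close>. The quasi-commutation relation holds in every window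
  of \<open>K\<close> indices and gives \<open>X\<^sub>n y = y Z\<^sub>n\<close>. The product \<open>X\<^sub>n\<^sub>+\<^sub>K Z\<^sub>n\<close> telescopes from the middle: each
  \<open>Y\<^sub>m\<^sub>+\<^sub>K Y\<^sub>m\<close> that appears is \<open>h\<^sub>m(X\<^sub>m)\<close> with \<open>X\<^sub>m\<close> containing the factor \<open>y\<close> and \<open>h\<^sub>m(0) = 1\<close>, whence
  \<open>X\<^sub>n\<^sub>+\<^sub>K Z\<^sub>n \<in> 1 + \<A>\<^sub>n y\<close>. As \<open>h\<^sub>n\<close> is palindromic of degree \<open>d\<close>, say, this yields
  \<open>h\<^sub>n(X\<^sub>n\<^sub>+\<^sub>K) \<equiv> X\<^sub>n\<^sub>+\<^sub>K\<^sup>d h\<^sub>n(Z\<^sub>n) = X\<^sub>n\<^sub>+\<^sub>K\<^sup>d Y\<^sub>n y \<equiv> 0\<close> modulo \<open>\<A>\<^sub>n y\<close>, and cancelling \<open>y\<close> in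
  \<open>Y\<^sub>n\<^sub>+\<^sub>2\<^sub>K y = h\<^sub>n(X\<^sub>n\<^sub>+\<^sub>K)\<close> shows \<open>Y\<^sub>n\<^sub>+\<^sub>2\<^sub>K \<in> \<A>\<^sub>n\<close>. The opposite direction follows from the symmetry
  \<open>Y\<^sub>n \<mapsto> Y\<^sub>-\<^sub>n\<close>, \<open>a\<^sub>n \<mapsto> b\<^sub>-\<^sub>n\<^sub>-\<^sub>1\<close>, \<open>b\<^sub>n \<mapsto> a\<^sub>-\<^sub>n\<^sub>-\<^sub>1\<close>.\<close>

section \<open>Polynomials modulo a left ideal\<close>

text \<open>Rational scalars enter the ring-theoretic argument only as central elements, so plain
  rings suffice instead of algebras.\<close>

definition center :: "('a, 'm) ring_scheme \<Rightarrow> 'a set" where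
  "center R = {c \<in> carrier R. \<forall>x\<in>carrier R. c \<otimes>\<^bsub>R\<^esub> x = x \<otimes>\<^bsub>R\<^esub> c}"

context ring
begin

text \<open>Coefficients are listed from the constant term upwards, so that a palindromic polynomial
  is one with \<open>rev cs = cs\<close>.\<close>

primrec horner :: "'a list \<Rightarrow> 'a \<Rightarrow> 'a" where
  "horner [] x = \<zero>"
| "horner (c # cs) x = c \<oplus> x \<otimes> horner cs x"

lemma centerD:
  assumes "c \<in> center R"
  shows "c \<in> carrier R" "x \<in> carrier R \<Longrightarrow> c \<otimes> x = x \<otimes> c"
  using assms by (auto simp: center_def)

lemma horner_closed:
  "\<lbrakk>set cs \<subseteq> carrier R; x \<in> carrier R\<rbrakk> \<Longrightarrow> horner cs x \<in> carrier R"
  by (induction cs) auto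

lemma horner_in_subring:
  "\<lbrakk>subring A R; set cs \<subseteq> A; x \<in> A\<rbrakk> \<Longrightarrow> horner cs x \<in> A"
  by (induction cs) (auto intro: subringE)

lemma pow_in_subring: "\<lbrakk>subring A R; x \<in> A\<rbrakk> \<Longrightarrow> x [^] (n::nat) \<in> A"
  by (induction n) (auto intro: subringE)

lemma center_carrier: "set cs \<subseteq> center R \<Longrightarrow> set cs \<subseteq> carrier R"
  by (auto simp: center_def)

text \<open>Moving \<open>y\<close> past a power of \<open>x\<close> turns it into the same power of
  \<open>z\<close>, and the coefficients are central. With \<open>x = z\<close> it says that a
  polynomial in \<open>x\<close> commutes with whatever commutes with \<open>x\<close>.\<close>

lemma horner_intertwine:
  assumes "set cs \<subseteq> center R" "x \<in> carrier R" "z \<in> carrier R" "y \<in> carrier R"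
    and "y \<otimes> x = z \<otimes> y"
  shows "y \<otimes> horner cs x = horner cs z \<otimes> y"
  using assms(1)
proof (induction cs)
  case Nil
  then show ?case using assms by simp
next
  case (Cons c cs)
  have cc: "c \<in> carrier R" "y \<otimes> c = c \<otimes> y"
    using Cons.prems assms(4) centerD[of c] by simp_all
  have hc: "horner cs x \<in> carrier R" "horner cs z \<in> carrier R"
    using Cons.prems assms horner_closed center_carrier by auto
  have "y \<otimes> (x \<otimes> horner cs x) = z \<otimes> (y \<otimes> horner cs x)"
    using assms hc m_assoc by metis
  also have "\<dots> = z \<otimes> horner cs z \<otimes> y"
    using Cons assms hc m_assoc by simp
  finally show ?case
    using cc hc assms by (simp add: r_distr l_distr)
qed

text \<open>Reversing a list turns its head into its last entry, so \<open>horner_rev_mod\<close>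
  needs the effect of a new top coefficient.\<close>

lemma horner_snoc:
  assumes "set cs \<subseteq> carrier R" "c \<in> center R" "x \<in> carrier R"
  shows "horner (cs @ [c]) x = horner cs x \<oplus> c \<otimes> x [^] length cs"
  using assms(1)
proof (induction cs)
  case Nil
  then show ?case using assms centerD by auto
next
  case (Cons e cs)
  have cl: "horner cs x \<in> carrier R" "c \<in> carrier R" "e \<in> carrier R"
    using Cons.prems assms horner_closed centerD by auto
  have "x \<otimes> (c \<otimes> x [^] length cs) = c \<otimes> (x \<otimes> x [^] length cs)"
    using centerD[OF assms(2)] assms(3) cl m_assoc nat_pow_closed by metis
  also have "x \<otimes> x [^] length cs = x [^] Suc (length cs)"
    using assms(3) by (metis nat_pow_Suc2)
  finally show ?case
    using Cons cl assms by (simp add: r_distr a_assoc)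
qed

lemma cancel_right:
  assumes "y \<in> Units R" "x \<in> carrier R" "z \<in> carrier R" "x \<otimes> y = z \<otimes> y"
  shows "x = z"
proof -
  have "x \<otimes> (y \<otimes> inv y) = z \<otimes> (y \<otimes> inv y)"
    using assms m_assoc Units_closed Units_inv_closed by metis
  then show ?thesis using assms by simp
qed

section \<open>Left multiples of an element over a subring\<close>

definition left_multiples :: "'a set \<Rightarrow> 'a \<Rightarrow> 'a set" where
  "left_multiples A y = {r \<otimes> y | r. r \<in> A}"

context
  fixes A y
  assumes A: "subring A R" and y: "y \<in> carrier R"
begin

lemma subring_carrier: "x \<in> A \<Longrightarrow> x \<in> carrier R"
  using subringE(1)[OF A] by auto

lemma left_multiples_closed: "u \<in> left_multiples A y \<Longrightarrow> u \<in> carrier R"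
  using subring_carrier y by (auto simp: left_multiples_def)

lemma left_multiplesI: "r \<in> A \<Longrightarrow> r \<otimes> y \<in> left_multiples A y"
  by (auto simp: left_multiples_def)

lemma left_multiples_add:
  assumes "u \<in> left_multiples A y" "v \<in> left_multiples A y"
  shows "u \<oplus> v \<in> left_multiples A y"
proof -
  obtain r s where "r \<in> A" "s \<in> A" "u = r \<otimes> y" "v = s \<otimes> y"
    using assms by (auto simp: left_multiples_def)
  then show ?thesis
    using left_multiplesI[of "r \<oplus> s"] subringE(7)[OF A] subring_carrier y by (simp add: l_distr)
qed

lemma left_multiples_lmult:
  assumes "u \<in> left_multiples A y" "x \<in> A"
  shows "x \<otimes> u \<in> left_multiples A y"
proof -
  obtain r where "r \<in> A" "u = r \<otimes> y"
    using assms by (auto simp: left_multiples_def)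
  then show ?thesis
    using left_multiplesI[of "x \<otimes> r"] subringE(6)[OF A] subring_carrier y assms
    by (simp add: m_assoc)
qed

text \<open>\<open>A y\<close> is one-sided; a factor on the right is absorbed only if
  \<open>y\<close> can be moved past it: \<open>r y z = (r x) y\<close>.\<close>

lemma left_multiples_rmult:
  assumes "u \<in> left_multiples A y" "x \<in> A" "z \<in> carrier R" "y \<otimes> z = x \<otimes> y"
  shows "u \<otimes> z \<in> left_multiples A y"
proof -
  obtain r where r: "r \<in> A" "u = r \<otimes> y"
    using assms by (auto simp: left_multiples_def)
  then have "u \<otimes> z = (r \<otimes> x) \<otimes> y"
    using assms subring_carrier y by (simp add: m_assoc)
  then show ?thesis
    using left_multiplesI[of "r \<otimes> x"] subringE(6)[OF A] r assms by simp
qed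

lemma left_multiples_a_inv:
  assumes "u \<in> left_multiples A y"
  shows "\<ominus> u \<in> left_multiples A y"
proof -
  obtain r where "r \<in> A" "u = r \<otimes> y"
    using assms by (auto simp: left_multiples_def)
  then show ?thesis
    using left_multiplesI[of "\<ominus> r"] subringE(5)[OF A] subring_carrier y by (simp add: l_minus)
qed

lemma left_multiples_zero: "\<zero> \<in> left_multiples A y"
  using left_multiplesI[OF subringE(2)[OF A]] y by simp

text \<open>Modulo \<open>A y\<close> the element \<open>z\<close> is a right inverse of \<open>x\<close>, so multiplying a polynomial
  in \<open>z\<close> by a power of \<open>x\<close> reverses its coefficients.\<close>

lemma horner_rev_mod:
  assumes cs: "set cs \<subseteq> center R" "set cs \<subseteq> A" and x: "x \<in> A" and z: "z \<in> A"
    and w: "w \<in> A" "y \<otimes> z = w \<otimes> y"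
    and u: "u \<in> left_multiples A y" "x \<otimes> z = \<one> \<oplus> u"
  shows "\<exists>v\<in>left_multiples A y.
    x [^] length cs \<otimes> (z \<otimes> horner cs z) = horner (rev cs) x \<oplus> v"
  using cs
proof (induction cs)
  case Nil
  show ?case
    using x z subring_carrier by (intro bexI[OF _ left_multiples_zero]) simp
next
  case (Cons c cs)
  let ?n = "length cs" and ?H = "c \<oplus> z \<otimes> horner cs z"
  obtain v where v: "v \<in> left_multiples A y"
    "x [^] ?n \<otimes> (z \<otimes> horner cs z) = horner (rev cs) x \<oplus> v"
    using Cons by auto
  have xz: "x \<in> carrier R" "z \<in> carrier R" "c \<in> carrier R"
    and cs: "set cs \<subseteq> carrier R"
    using x z subring_carrier Cons.prems by auto
  have pn: "x [^] ?n \<in> A" using pow_in_subring[OF A x] .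
  have cl: "horner cs z \<in> carrier R" "horner (rev cs) x \<in> carrier R" "v \<in> carrier R"
    "u \<in> carrier R" "x [^] ?n \<in> carrier R" "?H \<in> carrier R"
    using horner_closed xz cs left_multiples_closed v(1) u(1) by auto
  \<comment> \<open>The error \<open>u\<close> will be followed by the value at \<open>z\<close>;
    since \<open>y\<close> intertwines it with the value at \<open>w\<close>, which lies in
    \<open>A\<close>, the product stays in \<open>A y\<close>.\<close>
  have "y \<otimes> horner (c # cs) z = horner (c # cs) w \<otimes> y"
    using Cons.prems xz w subring_carrier y by (intro horner_intertwine) auto
  then have uH: "u \<otimes> ?H \<in> left_multiples A y"
    using left_multiples_rmult[OF u(1) horner_in_subring[OF A Cons.prems(2) w(1)] cl(6)] by simp
  have distr: "p \<otimes> ((\<one> \<oplus> u) \<otimes> q) = p \<otimes> q \<oplus> p \<otimes> (u \<otimes> q)"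
    if "p \<in> carrier R" "u \<in> carrier R" "q \<in> carrier R" for p u q
    using that by (simp add: l_distr r_distr)
  have "x [^] length (c # cs) \<otimes> (z \<otimes> horner (c # cs) z) = x [^] ?n \<otimes> ((x \<otimes> z) \<otimes> ?H)"
    using xz cl by (simp add: m_assoc)
  \<comment> \<open>One factor \<open>x\<close> of the power has met the extra factor
    \<open>z\<close> and becomes \<open>1 + u\<close>.\<close>
  also have "\<dots> = x [^] ?n \<otimes> ?H \<oplus> x [^] ?n \<otimes> (u \<otimes> ?H)"
    unfolding u(2) using distr cl by blast
  also have "x [^] ?n \<otimes> ?H = c \<otimes> x [^] ?n \<oplus> (horner (rev cs) x \<oplus> v)"
    using centerD(2)[of c "x [^] ?n"] Cons.prems(1) xz cl v(2) by (simp add: r_distr)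
  also have "c \<otimes> x [^] ?n \<oplus> (horner (rev cs) x \<oplus> v) = horner (rev (c # cs)) x \<oplus> v"
    using horner_snoc[of "rev cs" c x] Cons.prems xz cl cs by (simp add: a_ac)
  finally show ?case
    using v(1) left_multiples_lmult[OF uH pn] left_multiples_add left_multiples_closed
      horner_closed[of "rev (c # cs)" x] xz cs
    by (intro bexI[of _ "v \<oplus> x [^] ?n \<otimes> (u \<otimes> ?H)"]) (auto simp: a_assoc)
qed

text \<open>The reversed polynomial in \<open>horner_rev_mod\<close> is now the original one, and
  its left-hand side lies in \<open>A y\<close> together with \<open>horner cs z\<close>. The
  exponent there is one more than the formal degree, which the extra factor \<open>z\<close>
  balances.\<close>

lemma horner_palindromic_mod:
  assumes cs: "set cs \<subseteq> center R" "set cs \<subseteq> A" and x: "x \<in> A" and z: "z \<in> A"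
    and w: "w \<in> A" "y \<otimes> z = w \<otimes> y"
    and u: "u \<in> left_multiples A y" "x \<otimes> z = \<one> \<oplus> u"
    and palindromic: "rev cs = cs" and multiple: "horner cs z \<in> left_multiples A y"
  shows "horner cs x \<in> left_multiples A y"
proof -
  obtain v where v: "v \<in> left_multiples A y"
    "x [^] length cs \<otimes> (z \<otimes> horner cs z) = horner cs x \<oplus> v"
    using horner_rev_mod[OF cs x z w u] palindromic by auto
  have "horner cs x \<oplus> v \<in> left_multiples A y"
    using v(2) left_multiples_lmult[OF left_multiples_lmult[OF multiple z] pow_in_subring[OF A x]]
    by metis
  then have "(horner cs x \<oplus> v) \<oplus> \<ominus> v \<in> left_multiples A y"
    using left_multiples_add left_multiples_a_inv v(1) by blast
  then show ?thesis
    using v(1) left_multiples_closed horner_closed[of cs x] cs(2) x subring_carrier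
    by (simp add: a_assoc r_neg subset_iff)
qed

end

text \<open>With \<open>k = K - 1\<close>, the arguments of \<open>h\<^sub>n\<close> in the two forms of the recursion are
  \<open>fwd a Y n k\<close> (for \<open>Y\<^sub>n\<^sub>+\<^sub>K Y\<^sub>n\<close>) and \<open>bwd b Y n k\<close> (for \<open>Y\<^sub>n Y\<^sub>n\<^sub>+\<^sub>K\<close>).\<close>

primrec fwd :: "(int \<Rightarrow> 'a) \<Rightarrow> (int \<Rightarrow> 'a) \<Rightarrow> int \<Rightarrow> nat \<Rightarrow> 'a" where
  "fwd a Y n 0 = a n"
| "fwd a Y n (Suc j) = fwd a Y n j \<otimes> Y (n + int j + 1) \<otimes> a (n + int j + 1)"

primrec bwd :: "(int \<Rightarrow> 'a) \<Rightarrow> (int \<Rightarrow> 'a) \<Rightarrow> int \<Rightarrow> nat \<Rightarrow> 'a" where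
  "bwd b Y n 0 = b n"
| "bwd b Y n (Suc j) = b (n + int j + 1) \<otimes> Y (n + int j + 1) \<otimes> bwd b Y n j"

text \<open>The recursion of \<open>fwd\<close> only exposes the right end; cutting at an arbitrary
  inner \<open>Y\<close> also reaches the left end or a chosen \<open>Y\<close> in the
  middle.\<close>

lemma fwd_split:
  assumes "\<And>n. a n \<in> carrier R" "\<And>n. Y n \<in> carrier R"
  shows "fwd a Y n j \<in> carrier R"
    "fwd a Y n (Suc (i + j)) = fwd a Y n i \<otimes> Y (n + int i + 1) \<otimes> fwd a Y (n + int i + 1) j"
proof -
  show cl: "fwd a Y n j \<in> carrier R" for n j by (induction j) (use assms in auto)
  show "fwd a Y n (Suc (i + j)) = fwd a Y n i \<otimes> Y (n + int i + 1) \<otimes> fwd a Y (n + int i + 1) j"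
    by (induction j) (use assms cl in \<open>simp_all add: m_assoc algebra_simps\<close>)
qed

lemma bwd_split:
  assumes "\<And>n. b n \<in> carrier R" "\<And>n. Y n \<in> carrier R"
  shows "bwd b Y n j \<in> carrier R"
    "bwd b Y n (Suc (i + j)) = bwd b Y (n + int i + 1) j \<otimes> Y (n + int i + 1) \<otimes> bwd b Y n i"
proof -
  show cl: "bwd b Y n j \<in> carrier R" for n j by (induction j) (use assms in auto)
  show "bwd b Y n (Suc (i + j)) = bwd b Y (n + int i + 1) j \<otimes> Y (n + int i + 1) \<otimes> bwd b Y n i"
    by (induction j) (use assms cl in \<open>simp_all add: m_assoc algebra_simps\<close>)
qed

lemma fwd_in_subring:
  "\<lbrakk>subring A R; \<And>i. a i \<in> A; \<And>i. \<lbrakk>n < i; i \<le> n + int j\<rbrakk> \<Longrightarrow> Y i \<in> A\<rbrakk> \<Longrightarrow> fwd a Y n j \<in> A"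
  by (induction j) (auto intro!: subringE(6))

lemma bwd_in_subring:
  "\<lbrakk>subring A R; \<And>i. b i \<in> A; \<And>i. \<lbrakk>n < i; i \<le> n + int j\<rbrakk> \<Longrightarrow> Y i \<in> A\<rbrakk> \<Longrightarrow> bwd b Y n j \<in> A"
  by (induction j) (auto intro!: subringE(6))

text \<open>Reflecting the indices turns a forward word into the backward word of the reflected
  window. The new factor appears at the right end, whereas \<open>bwd\<close> grows at the left,
  hence \<open>bwd_split\<close> with first part of length 0.\<close>

lemma fwd_reverse:
  assumes "\<And>n. b n \<in> carrier R" "\<And>n. Y n \<in> carrier R"
  shows "fwd (\<lambda>m. b (- m - 1)) (\<lambda>m. Y (- m)) n j = bwd b Y (- n - 1 - int j) j"
proof (induction j)
  case (Suc j)
  moreover have "- n - 1 - int (Suc j) + int 0 + 1 = - n - 1 - int j"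
    "- n - 1 - int (Suc j) = - (n + int j + 1) - 1" "- n - 1 - int j = - (n + int j + 1)"
    by simp_all
  ultimately show ?case
    using bwd_split(2)[of b Y "- n - 1 - int (Suc j)" 0 j] assms bwd_split(1)[of b Y]
    by (simp add: m_assoc)
qed simp

lemma bwd_reverse:
  assumes "\<And>n. a n \<in> carrier R" "\<And>n. Y n \<in> carrier R"
  shows "bwd (\<lambda>m. a (- m - 1)) (\<lambda>m. Y (- m)) n j = fwd a Y (- n - 1 - int j) j"
proof (induction j)
  case (Suc j)
  moreover have "- n - 1 - int (Suc j) + int 0 + 1 = - n - 1 - int j"
    "- n - 1 - int (Suc j) = - (n + int j + 1) - 1" "- n - 1 - int j = - (n + int j + 1)"
    by simp_all
  ultimately show ?case
    using fwd_split(2)[of a Y "- n - 1 - int (Suc j)" 0 j] assms fwd_split(1)[of a Y]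
    by (simp add: m_assoc)
qed simp

end

section \<open>The palindromic recursion\<close>

text \<open>Here \<open>K = k + 1\<close> and \<open>cs n\<close> lists the coefficients of
  \<open>h n\<close>. Each relation comes with its mirror image, so that the axioms are stable under
  reflection of the indices.\<close>

locale palindromic_recursion = ring R for R (structure) +
  fixes a b Y :: "int \<Rightarrow> 'a" and k :: nat and cs :: "int \<Rightarrow> 'a list"
  assumes closed: "a n \<in> carrier R" "b n \<in> carrier R"
    and Y_unit: "Y n \<in> Units R"
    and ab: "a (n + int k + 1) \<otimes> b n = \<one>" "b n \<otimes> a (n + int k + 1) = \<one>"
      "a n \<otimes> b (n + int k + 1) = \<one>" "b (n + int k + 1) \<otimes> a n = \<one>"
    and cs_center: "set (cs n) \<subseteq> center R"
    and cs_hd: "\<exists>ds. cs n = \<one> # ds"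
    and cs_rev: "rev (cs n) = cs n"
    and cs_period: "cs (n + int k + 1) = cs n"
    and rec: "Y (n + int k + 1) \<otimes> Y n = horner (cs n) (fwd a Y n k)"
    and rec': "Y n \<otimes> Y (n + int k + 1) = horner (cs n) (bwd b Y n k)"
    and comm: "Y n \<otimes> fwd a Y n k = bwd b Y n k \<otimes> Y n"
    and comm': "fwd a Y n k \<otimes> Y (n + int k + 1) = Y (n + int k + 1) \<otimes> bwd b Y n k"
begin

lemma Y_closed: "Y n \<in> carrier R"
  using Y_unit Units_closed by blast

lemmas fwd_split' = fwd_split[of a Y, OF closed(1) Y_closed]
lemmas bwd_split' = bwd_split[of b Y, OF closed(2) Y_closed]

text \<open>Reflection exchanges \<open>fwd\<close> with \<open>bwd\<close>, hence
  \<open>rec\<close> with \<open>rec'\<close> and \<open>comm\<close> with \<open>comm'\<close>. The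
  window starting at \<open>m\<close> becomes the one starting at \<open>- m - 1 - k\<close>, which
  explains the index of \<open>cs\<close>.\<close>

lemma reversed:
  "palindromic_recursion R (\<lambda>m. b (- m - 1)) (\<lambda>m. a (- m - 1)) (\<lambda>m. Y (- m)) k
    (\<lambda>m. cs (- m - 1 - int k))"
proof -
  have idx: "- (n + int k + 1) - 1 = - n - 2 - int k" "- n - 2 - int k + int k + 1 = - n - 1"
    "- n - 2 - int k - int k + int k + 1 = - n - 1 - int k" for n
    by simp_all
  have idx': "- (n + int k + 1) = - n - 1 - int k" "- n - 1 - int k + int k + 1 = - n" for n
    by simp_all
  note reverse = fwd_reverse[of b Y, OF closed(2) Y_closed] bwd_reverse[of a Y, OF closed(1) Y_closed]
  show ?thesis
  proof (unfold_locales, goal_cases)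
    case (4 n)
    show ?case using ab(2)[of "- n - 2 - int k"] by (simp only: idx)
  next
    case (5 n)
    show ?case using ab(1)[of "- n - 2 - int k"] by (simp only: idx)
  next
    case (6 n)
    show ?case using ab(4)[of "- n - 2 - int k"] by (simp only: idx)
  next
    case (7 n)
    show ?case using ab(3)[of "- n - 2 - int k"] by (simp only: idx)
  next
    case (11 n)
    show ?case using cs_period[of "- n - 2 - int k - int k"] by (simp only: idx)
  next
    case (12 n)
    show ?case using rec'[of "- n - 1 - int k"]
      by (simp only: reverse idx')
  next
    case (13 n)
    show ?case using rec[of "- n - 1 - int k"]
      by (simp only: reverse idx')
  next
    case (14 n)
    show ?case using comm'[of "- n - 1 - int k"]
      by (simp only: reverse idx')
  next
    case (15 n)
    show ?case using comm[of "- n - 1 - int k"]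
      by (simp only: reverse idx')
  qed (use closed Y_unit cs_center cs_hd cs_rev in auto)
qed

context
  fixes A n
  assumes A: "subring A R"
    and abA: "\<And>i. a i \<in> A" "\<And>i. b i \<in> A"
    and csA: "\<And>i. set (cs i) \<subseteq> A"
    and YA: "\<And>i. \<lbrakk>n \<le> i; i \<le> n + 2 * int k + 1\<rbrakk> \<Longrightarrow> Y i \<in> A"
begin

text \<open>Passing from \<open>j\<close> to \<open>j + 1\<close> inserts new factors between
  \<open>P\<close> and \<open>Q\<close>. The inner \<open>a\<close> and \<open>b\<close> cancel, and
  the remaining pair of \<open>Y\<close> is \<open>1 + D X\<close> with \<open>X = E y P\<close>, so
  the correction ends in \<open>y P Q = y (1 + u)\<close>.\<close>

lemma fwd_bwd_mod:
  assumes "j \<le> k"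
  shows "\<exists>u\<in>left_multiples A (Y (n + int k + 1)).
    fwd a Y (n + int k + 1) j \<otimes> bwd b Y n j = \<one> \<oplus> u"
  using assms
proof (induction j)
  case 0
  show ?case using ab(1) left_multiples_zero[OF A Y_closed] by (intro bexI[of _ \<zero>]) auto
next
  case (Suc j)
  let ?y = "Y (n + int k + 1)" and ?P = "fwd a Y (n + int k + 1) j" and ?Q = "bwd b Y n j"
  define m where "m = n + int j + 1"
  let ?E = "fwd a Y m (k - Suc j)" and ?X = "fwd a Y m k" and ?L = "left_multiples A ?y"
  obtain u where u: "u \<in> ?L" "?P \<otimes> ?Q = \<one> \<oplus> u" using Suc by auto
  \<comment> \<open>As \<open>j < k\<close>, the window of \<open>X\<close> contains the index of
    \<open>y\<close>; what follows \<open>y\<close> there is exactly \<open>P\<close>.\<close>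
  have "m + int (k - Suc j) + 1 = n + int k + 1" and "Suc (k - Suc j + j) = k"
    using Suc.prems by (simp_all add: m_def)
  then have X: "?X = ?E \<otimes> ?y \<otimes> ?P"
    using fwd_split'(2)[of m "k - Suc j" j] by (simp only:)
  obtain ds where ds: "cs m = \<one> # ds" using cs_hd by blast
  define D where "D = horner ds ?X"
  have inA: "?E \<in> A" "?P \<in> A" "?y \<in> A"
    using Suc.prems by (auto intro!: fwd_in_subring A abA YA simp: m_def)
  then have "?X \<in> A" unfolding X by (intro subringE(6)[OF A])
  then have D: "D \<in> A"
    unfolding D_def using csA[of m] ds by (intro horner_in_subring[OF A]) auto
  have carr: "?E \<in> carrier R" "?y \<in> carrier R" "?P \<in> carrier R" "?Q \<in> carrier R"
    "D \<in> carrier R" "?X \<in> carrier R" "u \<in> carrier R"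
    using fwd_split'(1) bwd_split'(1) Y_closed D subring_carrier[OF A]
      left_multiples_closed[OF A Y_closed u(1)] by auto
  \<comment> \<open>\<open>horner\<close> produces \<open>1 + X D\<close>; the order is exchanged so
    that \<open>X\<close>, and with it \<open>y P\<close>, stands next to \<open>Q\<close>.\<close>
  have "?X \<otimes> D = D \<otimes> ?X"
    unfolding D_def using cs_center[of m] ds carr by (intro horner_intertwine) auto
  then have h: "Y (m + int k + 1) \<otimes> Y m = \<one> \<oplus> D \<otimes> ?X"
    using rec[of m] ds by (simp add: D_def)
  have idx: "n + int k + 1 + int j + 1 = m + int k + 1" by (simp add: m_def)
  have "fwd a Y (n + int k + 1) (Suc j) \<otimes> bwd b Y n (Suc j)
      = ?P \<otimes> (Y (m + int k + 1) \<otimes> ((a (m + int k + 1) \<otimes> b m) \<otimes> (Y m \<otimes> ?Q)))"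
    using carr closed Y_closed by (simp add: idx m_def[symmetric] m_assoc del: ab)
  also have "\<dots> = ?P \<otimes> ((Y (m + int k + 1) \<otimes> Y m) \<otimes> ?Q)"
    using ab(1)[of m] carr Y_closed by (simp add: m_assoc)
  also have "\<dots> = ?P \<otimes> ?Q \<oplus> ?P \<otimes> (D \<otimes> (?E \<otimes> (?y \<otimes> (?P \<otimes> ?Q))))"
    unfolding h X using carr by (simp add: l_distr r_distr m_assoc)
  also have "\<dots> = \<one> \<oplus> (u \<oplus> ?P \<otimes> (D \<otimes> (?E \<otimes> (\<one> \<otimes> ?y \<oplus> ?y \<otimes> u))))"
    unfolding u(2) using carr by (simp add: r_distr a_assoc)
  finally show ?case
    using u(1) inA D A Y_closed subringE(3)[OF A]
    by (intro bexI[of _ "u \<oplus> ?P \<otimes> (D \<otimes> (?E \<otimes> (\<one> \<otimes> ?y \<oplus> ?y \<otimes> u)))"] left_multiples_add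
        left_multiples_lmult left_multiplesI) auto
qed

lemma next_in_subring: "Y (n + 2 * int k + 2) \<in> A"
proof -
  let ?y = "Y (n + int k + 1)"
  have idx: "n + int k + 1 + int k + 1 = n + 2 * int k + 2" by simp
  obtain u where u: "u \<in> left_multiples A ?y"
    "fwd a Y (n + int k + 1) k \<otimes> bwd b Y n k = \<one> \<oplus> u"
    using fwd_bwd_mod by blast
  \<comment> \<open>By \<open>rec'\<close> this value is \<open>Y n\<close> times \<open>y\<close>,
    and \<open>Y n\<close> lies in \<open>A\<close>.\<close>
  have "horner (cs n) (bwd b Y n k) \<in> left_multiples A ?y"
    unfolding rec'[symmetric] by (intro left_multiplesI[OF A Y_closed] YA) auto
  \<comment> \<open>The intertwining partner \<open>w\<close> of \<open>bwd b Y n k\<close> is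
    \<open>fwd a Y n k\<close>, by \<open>comm'\<close>.\<close>
  then have "horner (cs n) (fwd a Y (n + int k + 1) k) \<in> left_multiples A ?y"
    by (intro horner_palindromic_mod[OF A Y_closed cs_center csA _ _ _ comm'[symmetric] u cs_rev]
        fwd_in_subring bwd_in_subring A abA YA) auto
  then obtain r where r: "r \<in> A" "Y (n + 2 * int k + 2) \<otimes> ?y = r \<otimes> ?y"
    using rec[of "n + int k + 1"] unfolding cs_period idx by (auto simp: left_multiples_def)
  then have "Y (n + 2 * int k + 2) = r"
    using cancel_right[OF Y_unit Y_closed subring_carrier[OF A]] by blast
  then show ?thesis using r(1) by simp
qed

end

text \<open>This is \<open>next_in_subring\<close> for the reflected sequence, whose window starting
  at \<open>- n - 2k - 2\<close> has \<open>- n\<close> as next index.\<close>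

lemma previous_in_subring:
  assumes "subring A R" "\<And>i. a i \<in> A" "\<And>i. b i \<in> A" "\<And>i. set (cs i) \<subseteq> A"
    and "\<And>i. \<lbrakk>n < i; i \<le> n + 2 * int k + 2\<rbrakk> \<Longrightarrow> Y i \<in> A"
  shows "Y n \<in> A"
proof -
  have "Y (- (- n - 2 * int k - 2 + 2 * int k + 2)) \<in> A"
    by (rule palindromic_recursion.next_in_subring[OF reversed assms(1)]) (use assms in auto)
  then show ?thesis by simp
qed

end

section \<open>Quasi-commutation in all windows\<close>

context ring
begin

text \<open>Conjugating by the invertible \<open>Y\<^sub>n\<close> propagates the quasi-commutation relation from one
  window of indices to its two neighbours.\<close>

lemma palindromic_recursionI:
  fixes a b Y :: "int \<Rightarrow> 'a" and k :: nat
  assumes closed: "\<And>n. a n \<in> carrier R" "\<And>n. b n \<in> carrier R"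
    and Y_unit: "\<And>n. Y n \<in> Units R"
    and ab: "\<And>n. a (n + int k + 1) \<otimes> b n = \<one>" "\<And>n. b n \<otimes> a (n + int k + 1) = \<one>"
      "\<And>n. a n \<otimes> b (n + int k + 1) = \<one>" "\<And>n. b (n + int k + 1) \<otimes> a n = \<one>"
    and cs: "\<And>n. set (cs n) \<subseteq> center R" "\<And>n. \<exists>ds. cs n = \<one> # ds" "\<And>n. rev (cs n) = cs n"
      "\<And>n. cs (n + int k + 1) = cs n"
    and rec: "\<And>n. Y (n + int k + 1) \<otimes> Y n = horner (cs n) (fwd a Y n k)"
    and comm: "Y n0 \<otimes> fwd a Y n0 k = bwd b Y n0 k \<otimes> Y n0"
    and k: "k > 0"
  shows "palindromic_recursion R a b Y k cs"
proof -
  have Y: "Y n \<in> carrier R" for n using Y_unit Units_closed by blast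
  note F = fwd_split[of a Y, OF closed(1) Y] and G = bwd_split[of b Y, OF closed(2) Y]
  let ?X = "\<lambda>n. fwd a Y n k" and ?Z = "\<lambda>n. bwd b Y n k" and ?S = "\<lambda>n. n + int k + 1"
  have H: "horner (cs n) (?X m) \<in> carrier R" "horner (cs n) (?Z m) \<in> carrier R" for n m
    using cs(1) F(1) G(1) center_carrier horner_closed by auto
  \<comment> \<open>After multiplication by \<open>Y n\<close> on the right, \<open>rec\<close>
    applies and \<open>Y n\<close> moves through the polynomial, turning the forward argument into
    the backward one.\<close>
  have rec': "Y n \<otimes> Y (?S n) = horner (cs n) (?Z n)" if "Y n \<otimes> ?X n = ?Z n \<otimes> Y n" for n
  proof (rule cancel_right[OF Y_unit])
    have "Y n \<otimes> Y (?S n) \<otimes> Y n = Y n \<otimes> horner (cs n) (?X n)"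
      using Y rec[of n] by (simp add: m_assoc)
    then show "Y n \<otimes> Y (?S n) \<otimes> Y n = horner (cs n) (?Z n) \<otimes> Y n"
      using horner_intertwine[OF cs(1) F(1) G(1) Y that] by simp
  qed (use Y H in auto)
  have X_h: "?X n \<otimes> (Y (?S n) \<otimes> Y n) = (Y (?S n) \<otimes> Y n) \<otimes> ?X n" for n
    unfolding rec by (rule horner_intertwine[OF cs(1) F(1) F(1) F(1) refl])
  \<comment> \<open>The two ends of one window are linked by \<open>Y (n + K) Y n\<close>, which
    commutes with the forward word because it is a polynomial in it.\<close>
  have comm_iff: "Y n \<otimes> ?X n = ?Z n \<otimes> Y n \<longleftrightarrow> ?X n \<otimes> Y (?S n) = Y (?S n) \<otimes> ?Z n" for n
  proof
    assume c: "Y n \<otimes> ?X n = ?Z n \<otimes> Y n"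
    have "?X n \<otimes> Y (?S n) \<otimes> Y n = ?X n \<otimes> (Y (?S n) \<otimes> Y n)"
      by (rule m_assoc[OF F(1) Y Y])
    also have "\<dots> = Y (?S n) \<otimes> (Y n \<otimes> ?X n)"
      unfolding X_h by (rule m_assoc[OF Y Y F(1)])
    also have "\<dots> = Y (?S n) \<otimes> ?Z n \<otimes> Y n"
      unfolding c by (rule m_assoc[OF Y G(1) Y, symmetric])
    finally show "?X n \<otimes> Y (?S n) = Y (?S n) \<otimes> ?Z n"
      by (rule cancel_right[OF Y_unit m_closed[OF F(1) Y] m_closed[OF Y G(1)]])
  next
    assume c: "?X n \<otimes> Y (?S n) = Y (?S n) \<otimes> ?Z n"
    have "Y (?S n) \<otimes> (Y n \<otimes> ?X n) = ?X n \<otimes> (Y (?S n) \<otimes> Y n)"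
      unfolding X_h by (rule m_assoc[OF Y Y F(1), symmetric])
    also have "\<dots> = ?X n \<otimes> Y (?S n) \<otimes> Y n"
      by (rule m_assoc[OF F(1) Y Y, symmetric])
    also have "\<dots> = Y (?S n) \<otimes> (?Z n \<otimes> Y n)"
      unfolding c by (rule m_assoc[OF Y G(1) Y])
    finally show "Y n \<otimes> ?X n = ?Z n \<otimes> Y n"
      using Units_l_cancel[OF Y_unit m_closed[OF Y F(1)] m_closed[OF G(1) Y]] by blast
  qed
  \<comment> \<open>Consecutive windows share inner words of length parameter \<open>l\<close>; this
    is where \<open>k > 0\<close> enters.\<close>
  obtain l where l: "k = Suc l" using k gr0_implies_Suc by blast
  \<comment> \<open>Multiplying by \<open>b (n + K)\<close> on the left and \<open>a (n + K)\<close>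
    on the right strips the outer \<open>a n\<close> and \<open>b n\<close> and completes the words
    of the next window; \<open>a n\<close> and \<open>b n\<close> undo this.\<close>
  have shift_iff: "?X n \<otimes> Y (?S n) = Y (?S n) \<otimes> ?Z n \<longleftrightarrow>
      Y (n + 1) \<otimes> ?X (n + 1) = ?Z (n + 1) \<otimes> Y (n + 1)" for n
  proof -
    let ?W = "fwd a Y (n + 1) l" and ?V = "bwd b Y (n + 1) l"
    have S: "n + 1 + int l + 1 = ?S n" using l by simp
    have X: "?X n = a n \<otimes> Y (n + 1) \<otimes> ?W" "?X (n + 1) = ?W \<otimes> Y (?S n) \<otimes> a (?S n)"
      subgoal using F(2)[of n 0 l] unfolding l by simp
      subgoal by (fact fwd.simps(2)[of a Y "n + 1" l, unfolded S, folded l])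
      done
    have Z: "?Z n = ?V \<otimes> Y (n + 1) \<otimes> b n" "?Z (n + 1) = b (?S n) \<otimes> Y (?S n) \<otimes> ?V"
      subgoal using G(2)[of n 0 l] unfolding l by simp
      subgoal by (fact bwd.simps(2)[of b Y "n + 1" l, unfolded S, folded l])
      done
    note cl = Y closed F(1) G(1)
    have cancel: "b (?S n) \<otimes> (a n \<otimes> x) = x" "a n \<otimes> (b (?S n) \<otimes> x) = x"
      "b n \<otimes> (a (?S n) \<otimes> x) = x" "a (?S n) \<otimes> (b n \<otimes> x) = x" if "x \<in> carrier R" for x
      using ab[of n] that closed by (simp_all add: m_assoc[symmetric])
    show ?thesis
    proof
      assume "?X n \<otimes> Y (?S n) = Y (?S n) \<otimes> ?Z n"
      then have "b (?S n) \<otimes> (?X n \<otimes> Y (?S n)) \<otimes> a (?S n) = b (?S n) \<otimes> (Y (?S n) \<otimes> ?Z n) \<otimes> a (?S n)"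
        by simp
      then show "Y (n + 1) \<otimes> ?X (n + 1) = ?Z (n + 1) \<otimes> Y (n + 1)"
        unfolding X Z using cl ab[of n] cancel by (simp add: m_assoc)
    next
      assume "Y (n + 1) \<otimes> ?X (n + 1) = ?Z (n + 1) \<otimes> Y (n + 1)"
      then have "a n \<otimes> (Y (n + 1) \<otimes> ?X (n + 1)) \<otimes> b n = a n \<otimes> (?Z (n + 1) \<otimes> Y (n + 1)) \<otimes> b n"
        by simp
      then show "?X n \<otimes> Y (?S n) = Y (?S n) \<otimes> ?Z n"
        unfolding X Z using cl ab[of n] cancel by (simp add: m_assoc)
    qed
  qed
  have comm_all: "Y n \<otimes> ?X n = ?Z n \<otimes> Y n" for n
  proof (induction n rule: int_induct[of _ n0])
    case (step1 i)
    then show ?case using comm_iff shift_iff by blast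
  next
    case (step2 i)
    then show ?case using comm_iff[of "i - 1"] shift_iff[of "i - 1"] by simp
  qed (rule comm)
  show ?thesis
    by unfold_locales
       (fact closed Y_unit ab cs rec rec'[OF comm_all] comm_all comm_iff[THEN iffD1, OF comm_all])+
qed

end

section \<open>The presented algebra\<close>

text \<open>A scalar sits on the empty word, so on monomials the claim is commutativity of the
  rationals; a polynomial is built by adding monomials with fresh words.\<close>

lemma nc_const_commute: "nc_const c * q = q * nc_const c"
proof (induction q rule: update_induct)
  case (update f w r)
  have "Poly_Mapping.update w r f = f + Poly_Mapping.single w r"
    using update(1) by (intro poly_mapping_eqI)
      (auto simp: lookup_update lookup_add lookup_single in_keys_iff when_def)
  then show ?case
    using update(3) by (simp add: nc_const_def mult_single mult.commute algebra_simps)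
qed simp

lemma nc_const_0 [simp]: "nc_const 0 = 0" and nc_const_1 [simp]: "nc_const 1 = 1"
  by (simp_all add: nc_const_def)

lemma nc_eval_pCons: "nc_eval (pCons c p) x = nc_const c + x * nc_eval p x"
proof (cases "p = 0")
  case False
  have "nc_const (coeff p i) * (x * x ^ i) = x * (nc_const (coeff p i) * x ^ i)" for i
    using nc_const_commute[of "coeff p i" x] by (metis mult.assoc)
  then show ?thesis
    using False by (simp add: nc_eval_def sum.atMost_Suc_shift sum_distrib_left del: sum.atMost_Suc)
qed (simp add: nc_eval_def)

lemma rev_coeffs_palindromic:
  assumes "monic_palindromic p"
  shows "rev (coeffs p) = coeffs p"
proof -
  have "p \<noteq> 0" using assms by (auto simp: monic_palindromic_def)
  then have len: "length (coeffs p) = Suc (degree p)" by (rule length_coeffs_degree)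
  have "rev (coeffs p) ! i = coeffs p ! i" if "i \<le> degree p" for i
  proof -
    have "rev (coeffs p) ! i = coeff p (degree p - i)"
      using that \<open>p \<noteq> 0\<close> len by (simp add: rev_nth coeffs_nth)
    also have "\<dots> = coeff p i"
      using assms that unfolding monic_palindromic_def by metis
    also have "\<dots> = coeffs p ! i"
      using that \<open>p \<noteq> 0\<close> by (simp add: coeffs_nth)
    finally show ?thesis .
  qed
  then show ?thesis
    by (intro nth_equalityI) (simp_all add: len less_Suc_eq_le)
qed

text \<open>Palindromicity at index 0 equates the constant coefficient with the leading one.\<close>

lemma coeffs_monic_palindromic:
  assumes "monic_palindromic p"
  shows "\<exists>ds. coeffs p = 1 # ds"
proof -
  have "p \<noteq> 0" using assms by (auto simp: monic_palindromic_def)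
  moreover have "coeff p 0 = 1" using assms by (auto simp: monic_palindromic_def)
  ultimately show ?thesis
    by (cases p) (auto simp: cCons_def)
qed

context
  fixes K :: int and h :: "int \<Rightarrow> rat poly"
  assumes K: "K > 0"
begin

interpretation F: ring "FKY K h"
  by (rule ring_FKY[OF K])

interpretation H: ring_hom_ring "free_algebra (letters K)" "FKY K h" "cls K h"
  by (rule ring_hom_ringI2[OF ring_free_algebra ring_FKY[OF K] cls_hom[OF K]])

abbreviation cst :: "rat \<Rightarrow> letter ncpoly set" where
  "cst c \<equiv> cls K h (nc_const c)"

lemma cls_surj:
  assumes "x \<in> carrier (FKY K h)"
  obtains p where "p \<in> carrier (free_algebra (letters K))" "x = cls K h p"
  using assms
  by (auto simp: FKY_def presented_algebra_def FactRing_def A_RCOSETS_def RCOSETS_def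
      cls_def pclass_def a_r_coset_def)

lemma cls_closed:
  "p \<in> carrier (free_algebra (letters K)) \<Longrightarrow> cls K h p \<in> carrier (FKY K h)"
  by (rule H.hom_closed)

lemma elt_closed:
  "elt_a K h n \<in> carrier (FKY K h)" "elt_b K h n \<in> carrier (FKY K h)"
  "elt_Y K h n \<in> carrier (FKY K h)" "cst c \<in> carrier (FKY K h)"
  unfolding elt_a_def elt_b_def elt_Y_def
  by (intro cls_closed var_closed[OF K] free_algebra_const)+

lemma cls_mult:
  assumes "p \<in> carrier (free_algebra (letters K))" "q \<in> carrier (free_algebra (letters K))"
  shows "cls K h (p * q) = cls K h p \<otimes>\<^bsub>FKY K h\<^esub> cls K h q"
  using H.hom_mult[OF assms] by simp

text \<open>Centrality passes from the free algebra to the quotient because \<open>cls\<close> is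
  surjective.\<close>

lemma cst_center: "cst c \<in> center (FKY K h)"
  unfolding center_def
proof (intro CollectI conjI ballI elt_closed)
  fix x assume "x \<in> carrier (FKY K h)"
  then obtain p where p: "p \<in> carrier (free_algebra (letters K))" "x = cls K h p"
    by (rule cls_surj)
  then show "cst c \<otimes>\<^bsub>FKY K h\<^esub> x = x \<otimes>\<^bsub>FKY K h\<^esub> cst c"
    using nc_const_commute[of c p] by (simp add: cls_mult[symmetric] free_algebra_const)
qed

lemma cls_nc_eval:
  assumes "x \<in> carrier (free_algebra (letters K))"
  shows "cls K h (nc_eval p x) = F.horner (map cst (coeffs p)) (cls K h x)"
proof (induction p)
  case 0
  then show ?case using H.hom_zero by (simp add: nc_eval_def)
next
  case (pCons c p)
  have "cls K h (nc_eval (pCons c p) x) = cst c \<oplus>\<^bsub>FKY K h\<^esub> cls K h (x * nc_eval p x)"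
    using H.hom_add[OF free_algebra_const free_algebra_mult[OF assms free_algebra_eval[OF assms]]]
    by (simp add: nc_eval_pCons)
  then show ?case
    using pCons by (auto simp: cls_mult assms free_algebra_eval cCons_def)
qed

lemma cls_fwd:
  "cls K h (var_a K n * prod_list (map (\<lambda>i. var_Y i * var_a K i) [n+1..n + int j]))
    = F.fwd (elt_a K h) (elt_Y K h) n j"
proof (induction j)
  case 0
  then show ?case by (simp add: elt_a_def)
next
  case (Suc j)
  note v = var_closed[OF K]
  let ?p = "prod_list (map (\<lambda>i. var_Y i * var_a K i) [n+1..n + int j])"
  have p: "?p \<in> carrier (free_algebra (letters K))"
    by (auto intro!: free_algebra_prod_list free_algebra_mult v)
  have "[n + 1..n + int (Suc j)] = [n+1..n + int j] @ [n + int j + 1]"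
    by (subst upto_rec2) (auto simp: algebra_simps)
  then have "cls K h (var_a K n * prod_list (map (\<lambda>i. var_Y i * var_a K i) [n+1..n + int (Suc j)]))
      = cls K h ((var_a K n * ?p) * var_Y (n + int j + 1) * var_a K (n + int j + 1))"
    by (simp add: mult.assoc)
  then show ?case
    using Suc by (simp only: cls_mult free_algebra_mult p v F.fwd.simps elt_a_def elt_Y_def)
qed

text \<open>The last factor of the list is \<open>b n Y n\<close>, so one \<open>Y n\<close> is left
  over; at \<open>n = 1\<close> this is the right side of the quasi-commutation relation.\<close>

lemma cls_bwd:
  "cls K h (prod_list (map (\<lambda>i. var_b K i * var_Y i) (rev [n..n + int j])))
    = F.bwd (elt_b K h) (elt_Y K h) n j \<otimes>\<^bsub>FKY K h\<^esub> elt_Y K h n"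
proof (induction j)
  case 0
  then show ?case by (simp add: elt_b_def elt_Y_def cls_mult var_closed[OF K])
next
  case (Suc j)
  note v = var_closed[OF K]
  let ?p = "prod_list (map (\<lambda>i. var_b K i * var_Y i) (rev [n..n + int j]))"
  have p: "?p \<in> carrier (free_algebra (letters K))"
    by (auto intro!: free_algebra_prod_list free_algebra_mult v)
  have "[n..n + int (Suc j)] = [n..n + int j] @ [n + int j + 1]"
    by (subst upto_rec2) (auto simp: algebra_simps)
  then have "cls K h (prod_list (map (\<lambda>i. var_b K i * var_Y i) (rev [n..n + int (Suc j)])))
      = cls K h (var_b K (n + int j + 1) * var_Y (n + int j + 1) * ?p)"
    by (simp add: mult.assoc)
  also have "\<dots> = elt_b K h (n + int j + 1) \<otimes>\<^bsub>FKY K h\<^esub> elt_Y K h (n + int j + 1) \<otimes>\<^bsub>FKY K h\<^esub>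
      (F.bwd (elt_b K h) (elt_Y K h) n j \<otimes>\<^bsub>FKY K h\<^esub> elt_Y K h n)"
    unfolding Suc[symmetric] by (simp only: cls_mult free_algebra_mult p v elt_b_def elt_Y_def)
  finally show ?case
    using elt_closed F.bwd_split(1)[of "elt_b K h" "elt_Y K h" n j] by (simp add: F.m_assoc)
qed

lemma elt_ab_inverse:
  "elt_a K h (n + K) \<otimes>\<^bsub>FKY K h\<^esub> elt_b K h n = \<one>\<^bsub>FKY K h\<^esub>"
  "elt_b K h n \<otimes>\<^bsub>FKY K h\<^esub> elt_a K h (n + K) = \<one>\<^bsub>FKY K h\<^esub>"
  "elt_a K h n \<otimes>\<^bsub>FKY K h\<^esub> elt_b K h (n + K) = \<one>\<^bsub>FKY K h\<^esub>"
  "elt_b K h (n + K) \<otimes>\<^bsub>FKY K h\<^esub> elt_a K h n = \<one>\<^bsub>FKY K h\<^esub>"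
proof -
  have ll: "linv (linv l) = l" for l by (cases l) auto
  show "elt_a K h (n + K) \<otimes>\<^bsub>FKY K h\<^esub> elt_b K h n = \<one>\<^bsub>FKY K h\<^esub>"
    "elt_b K h n \<otimes>\<^bsub>FKY K h\<^esub> elt_a K h (n + K) = \<one>\<^bsub>FKY K h\<^esub>"
    "elt_a K h n \<otimes>\<^bsub>FKY K h\<^esub> elt_b K h (n + K) = \<one>\<^bsub>FKY K h\<^esub>"
    "elt_b K h (n + K) \<otimes>\<^bsub>FKY K h\<^esub> elt_a K h n = \<one>\<^bsub>FKY K h\<^esub>"
    using FKY_inverse[OF K linv_letters[OF letters_ab(1)[OF K, of n]], of h]
      FKY_inverse[OF K linv_letters[OF letters_ab(2)[OF K, of n]], of h]
      FKY_inverse[OF K letters_ab(1)[OF K, of n], of h]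
      FKY_inverse[OF K letters_ab(2)[OF K, of n], of h]
    by (simp_all add: elt_a_def elt_b_def var_a_def var_b_def ab_letter_shift[OF K] ll)
qed

lemma elt_Y_unit: "elt_Y K h n \<in> Units (FKY K h)"
proof -
  have "Pos (GY n) \<in> letters K" "Inv (GY n) \<in> letters K" by (auto simp: letters_def gens_def)
  then show ?thesis
    using FKY_inverse[OF K, of "Pos (GY n)" h] FKY_inverse[OF K, of "Inv (GY n)" h]
      elt_closed(3)[of n] cls_closed[OF free_algebra_var[of "Inv (GY n)"]]
    by (auto simp: Units_def elt_Y_def var_Y_def)
qed

text \<open>The presentation supplies quasi-commutation only for the indices 1 to \<open>K\<close>,
  hence the base window 1 in \<open>palindromic_recursionI\<close>.\<close>

lemma FKY_palindromic_recursion: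
  assumes "K \<ge> 2" "\<forall>n. monic_palindromic (h n)" "\<forall>n. h n = h (n - K)"
  shows "palindromic_recursion (FKY K h) (elt_a K h) (elt_b K h) (elt_Y K h) (nat (K - 1))
    (\<lambda>n. map cst (coeffs (h n)))"
proof (rule F.palindromic_recursionI[where ?n0.0 = 1])
  have k: "int (nat (K - 1)) = K - 1" using K by simp
  have S: "n + int (nat (K - 1)) + 1 = n + K" for n using k by simp
  note v = var_closed[OF K]
  fix n
  show "elt_a K h (n + int (nat (K - 1)) + 1) \<otimes>\<^bsub>FKY K h\<^esub> elt_b K h n = \<one>\<^bsub>FKY K h\<^esub>"
    "elt_b K h n \<otimes>\<^bsub>FKY K h\<^esub> elt_a K h (n + int (nat (K - 1)) + 1) = \<one>\<^bsub>FKY K h\<^esub>"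
    "elt_a K h n \<otimes>\<^bsub>FKY K h\<^esub> elt_b K h (n + int (nat (K - 1)) + 1) = \<one>\<^bsub>FKY K h\<^esub>"
    "elt_b K h (n + int (nat (K - 1)) + 1) \<otimes>\<^bsub>FKY K h\<^esub> elt_a K h n = \<one>\<^bsub>FKY K h\<^esub>"
    unfolding S by (fact elt_ab_inverse)+
  show "set (map cst (coeffs (h n))) \<subseteq> center (FKY K h)" using cst_center by auto
  have one: "cst 1 = \<one>\<^bsub>FKY K h\<^esub>" using H.hom_one by simp
  show "\<exists>ds. map cst (coeffs (h n)) = \<one>\<^bsub>FKY K h\<^esub> # ds"
    using coeffs_monic_palindromic[of "h n"] assms(2) one by auto
  show "rev (map cst (coeffs (h n))) = map cst (coeffs (h n))"
    using rev_coeffs_palindromic[of "h n"] assms(2) by (simp add: rev_map)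
  show "map cst (coeffs (h (n + int (nat (K - 1)) + 1))) = map cst (coeffs (h n))"
    unfolding S using assms(3)[rule_format, of "n + K"] by simp
  have p: "prod_list (map (\<lambda>i. var_Y i * var_a K i) is) \<in> carrier (free_algebra (letters K))" for "is"
    by (auto intro!: free_algebra_prod_list free_algebra_mult v)
  show "elt_Y K h (n + int (nat (K - 1)) + 1) \<otimes>\<^bsub>FKY K h\<^esub> elt_Y K h n =
      F.horner (map cst (coeffs (h n))) (F.fwd (elt_a K h) (elt_Y K h) n (nat (K - 1)))"
    unfolding S FKY_recursion[OF K] cls_nc_eval[OF free_algebra_mult[OF v(1) p]]
    using cls_fwd[of n "nat (K - 1)", unfolded k] by (simp add: add_diff_eq)
  have "[1..K] = 1 # [1 + 1..K]" using K by (subst upto_rec1) auto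
  then have "cls K h (prod_list (map (\<lambda>i. var_Y i * var_a K i) [1..K])) =
      elt_Y K h 1 \<otimes>\<^bsub>FKY K h\<^esub> cls K h (var_a K 1 * prod_list (map (\<lambda>i. var_Y i * var_a K i) [1+1..K]))"
    by (simp add: elt_Y_def cls_mult[symmetric] v p free_algebra_mult mult.assoc)
  then show "elt_Y K h 1 \<otimes>\<^bsub>FKY K h\<^esub> F.fwd (elt_a K h) (elt_Y K h) 1 (nat (K - 1)) =
      F.bwd (elt_b K h) (elt_Y K h) 1 (nat (K - 1)) \<otimes>\<^bsub>FKY K h\<^esub> elt_Y K h 1"
    using FKY_quasi_commutation[OF K, of h] cls_fwd[of 1 "nat (K - 1)", unfolded k]
      cls_bwd[of 1 "nat (K - 1)", unfolded k]
    by simp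
  show "nat (K - 1) > 0" using assms(1) by simp
qed (rule elt_closed elt_Y_unit)+

section \<open>The subalgebras \<open>FK\<close> and \<open>alg_A\<close>\<close>

lemma gen_subalgebra_FKY:
  "gen_subalgebra (letters K) (relators K h) G = generate_ring (FKY K h) (range cst \<union> G)"
  by (simp add: gen_subalgebra_def FKY_def cls_def)

definition FK_gens :: "letter ncpoly set set" where
  "FK_gens = range cst \<union> (\<Union>i\<in>{1..K}. {elt_a K h i, inv\<^bsub>FKY K h\<^esub> (elt_a K h i),
                   elt_b K h i, inv\<^bsub>FKY K h\<^esub> (elt_b K h i)})"

lemma FK_eq: "FK K h = generate_ring (FKY K h) FK_gens"
  by (simp add: FK_def gen_subalgebra_FKY FK_gens_def)

lemma elt_ab_unit: "elt_a K h n \<in> Units (FKY K h)" "elt_b K h n \<in> Units (FKY K h)"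
  using elt_ab_inverse[of n] elt_closed by (auto simp: Units_def)

lemma FK_carrier: "FK K h \<subseteq> carrier (FKY K h)"
  unfolding FK_eq
  by (rule F.generate_ring_incl) (auto simp: FK_gens_def elt_closed elt_ab_unit)

text \<open>With \<open>i\<close> the representative of \<open>n\<close> modulo \<open>K\<close> in
  1 to \<open>K\<close>, the parity of the quotient decides whether \<open>a n\<close> is
  \<open>a i\<close> or the inverse of \<open>b i\<close>, and likewise for
  \<open>b n\<close>.\<close>

lemma elt_ab_in_FK: "elt_a K h n \<in> FK K h" "elt_b K h n \<in> FK K h"
proof -
  define i where "i = (n - 1) mod K + 1"
  have i: "i \<in> {1..K}"
    using pos_mod_bound[OF K, of "n - 1"] pos_mod_sign[OF K, of "n - 1"]
    unfolding i_def atLeastAtMost_iff by linarith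
  have letters: "a_letter K n \<in> {Pos (GA i), Inv (GB i)}" "b_letter K n \<in> {Pos (GB i), Inv (GA i)}"
    by (simp_all add: a_letter_def b_letter_def Let_def i_def)
  have inverse: "cls K h (nc_var (Inv g)) = inv\<^bsub>FKY K h\<^esub> cls K h (nc_var (Pos g))"
    if "g \<in> gens K" for g
  proof (rule F.inv_unique')
    have "Pos g \<in> letters K" "Inv g \<in> letters K" using that by (auto simp: letters_def)
    then show "cls K h (nc_var (Pos g)) \<in> carrier (FKY K h)"
      "cls K h (nc_var (Inv g)) \<in> carrier (FKY K h)"
      "cls K h (nc_var (Pos g)) \<otimes>\<^bsub>FKY K h\<^esub> cls K h (nc_var (Inv g)) = \<one>\<^bsub>FKY K h\<^esub>"
      "cls K h (nc_var (Inv g)) \<otimes>\<^bsub>FKY K h\<^esub> cls K h (nc_var (Pos g)) = \<one>\<^bsub>FKY K h\<^esub>"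
      using FKY_inverse[OF K, of "Pos g" h] FKY_inverse[OF K, of "Inv g" h]
      by (auto intro!: cls_closed free_algebra_var)
  qed
  have "GA i \<in> gens K" "GB i \<in> gens K" using i by (auto simp: gens_def)
  moreover have "elt_a K h i = cls K h (nc_var (Pos (GA i)))"
    "elt_b K h i = cls K h (nc_var (Pos (GB i)))"
    by (simp_all add: elt_a_def elt_b_def var_a_def var_b_def ab_letter_initial[OF i])
  ultimately have inv_elt: "cls K h (nc_var (Inv (GA i))) = inv\<^bsub>FKY K h\<^esub> (elt_a K h i)"
    "cls K h (nc_var (Inv (GB i))) = inv\<^bsub>FKY K h\<^esub> (elt_b K h i)"
    and elt: "cls K h (nc_var (Pos (GA i))) = elt_a K h i" "cls K h (nc_var (Pos (GB i))) = elt_b K h i"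
    using inverse by simp_all
  have "elt_a K h n = elt_a K h i \<or> elt_a K h n = inv\<^bsub>FKY K h\<^esub> (elt_b K h i)"
    "elt_b K h n = elt_b K h i \<or> elt_b K h n = inv\<^bsub>FKY K h\<^esub> (elt_a K h i)"
    using letters inv_elt elt unfolding elt_a_def[of K h n] elt_b_def[of K h n] var_a_def var_b_def
    by (elim insertE emptyE; simp only:; blast)+
  moreover have "{elt_a K h i, inv\<^bsub>FKY K h\<^esub> (elt_a K h i),
      elt_b K h i, inv\<^bsub>FKY K h\<^esub> (elt_b K h i)} \<subseteq> FK_gens"
    unfolding FK_gens_def by (intro le_supI2 UN_upper i)
  then have "{elt_a K h i, inv\<^bsub>FKY K h\<^esub> (elt_a K h i),
      elt_b K h i, inv\<^bsub>FKY K h\<^esub> (elt_b K h i)} \<subseteq> FK K h"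
    unfolding FK_eq using generate_ring.incl by (rule subset_trans[OF _ subsetI])
  ultimately show "elt_a K h n \<in> FK K h" "elt_b K h n \<in> FK K h"
    unfolding insert_subset by (elim conjE disjE; simp only:)+
qed

lemma alg_A_eq: "alg_A K h n =
    generate_ring (FKY K h) (range cst \<union> (FK K h \<union> elt_Y K h ` {n..n+2*K-1}))"
  by (simp add: alg_A_def gen_subalgebra_FKY)

lemma alg_A_gens_carrier:
  "range cst \<union> (FK K h \<union> elt_Y K h ` {n..n+2*K-1}) \<subseteq> carrier (FKY K h)"
  using FK_carrier elt_closed by auto

lemma alg_A_least:
  assumes "subring A (FKY K h)" "range cst \<subseteq> A" "FK K h \<subseteq> A"
    and "\<And>i. \<lbrakk>n \<le> i; i \<le> n + 2 * K - 1\<rbrakk> \<Longrightarrow> elt_Y K h i \<in> A"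
  shows "alg_A K h n \<subseteq> A"
  unfolding alg_A_eq
  by (rule F.generate_ring_min_subring1[OF alg_A_gens_carrier assms(1)]) (use assms in auto)

lemma alg_A_subring: "subring (alg_A K h n) (FKY K h)"
  unfolding alg_A_eq by (rule F.generate_ring_is_subring[OF alg_A_gens_carrier])

lemma alg_A_incl:
  "range cst \<subseteq> alg_A K h n" "FK K h \<subseteq> alg_A K h n"
  "\<lbrakk>n \<le> i; i \<le> n + 2 * K - 1\<rbrakk> \<Longrightarrow> elt_Y K h i \<in> alg_A K h n"
  unfolding alg_A_eq by (auto intro: generate_ring.incl)

text \<open>The two generating sets differ only in \<open>Y n\<close> and \<open>Y (n + 2K)\<close>,
  so one membership in each direction suffices.\<close>

lemma alg_A_Suc:
  assumes "K \<ge> 2" "\<forall>n. monic_palindromic (h n)" "\<forall>n. h n = h (n - K)"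
  shows "alg_A K h (n + 1) = alg_A K h n"
proof -
  interpret P: palindromic_recursion "FKY K h" "elt_a K h" "elt_b K h" "elt_Y K h" "nat (K - 1)"
    "\<lambda>n. map cst (coeffs (h n))"
    by (rule FKY_palindromic_recursion[OF assms])
  have k: "int (nat (K - 1)) = K - 1" using K by simp
  have ab: "elt_a K h i \<in> alg_A K h m" "elt_b K h i \<in> alg_A K h m"
    "set (map cst (coeffs (h i))) \<subseteq> alg_A K h m" for i m
    using elt_ab_in_FK[of i] alg_A_incl(1,2)[of m] by auto
  have idx: "n + 2 * (K - 1) + 2 = n + 2 * K" by simp
  have up: "elt_Y K h (n + 2 * K) \<in> alg_A K h n"
    using P.next_in_subring[OF alg_A_subring[of n] ab, of n] alg_A_incl(3)[of n]
    unfolding k idx by simp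
  have down: "elt_Y K h n \<in> alg_A K h (n + 1)"
    using P.previous_in_subring[OF alg_A_subring[of "n + 1"] ab, of n] alg_A_incl(3)[of "n + 1"]
    unfolding k idx by simp
  show ?thesis
  proof (rule equalityI; rule alg_A_least)
    show "elt_Y K h i \<in> alg_A K h n" if "n + 1 \<le> i" "i \<le> n + 1 + 2 * K - 1" for i
      using that up alg_A_incl(3)[of n i] by (cases "i = n + 2 * K") auto
    show "elt_Y K h i \<in> alg_A K h (n + 1)" if "n \<le> i" "i \<le> n + 2 * K - 1" for i
      using that down alg_A_incl(3)[of "n + 1" i] by (cases "i = n") auto
  qed (rule alg_A_subring alg_A_incl)+
qed

end

theorem theorem2:
  fixes K :: int and h :: "int \<Rightarrow> rat poly"
  assumes "K \<ge> 2"
    and "\<forall>n. monic_palindromic (h n)"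
    and "\<forall>n. h n = h (n - K)"
  shows "\<forall>n. alg_A K h n = alg_A K h 0"
proof
  fix n
  have K: "K > 0" using assms(1) by simp
  note step = alg_A_Suc[OF K assms]
  show "alg_A K h n = alg_A K h 0"
  proof (induction n rule: int_induct[of _ 0])
    case (step2 i)
    then show ?case using step[of "i - 1"] by simp
  qed (use step in auto)
qed

end
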